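(* Let $d\ge 1$ and let $\mu$ be a nice measure in $\mathbb{R}^d$. Then there is a convex partition $\mathcal{P}$ of $\mathbb{R}^d$ into $3\cdot 2^{d-1}$ parts of equal $\mu$-measure such that every hyperplane in $\mathbb{R}^d$ avoids at least two elements of $\mathcal{P}$.
   Context: A nice measure on $\mathbb{R}^d$ is a finite nonzero Borel measure that has a continuous, everywhere strictly positive density with respect to Lebesgue measure. A convex partition of $\mathbb{R}^d$ into $n$ parts is a covering $\mathcal{P}=\{C_1,\dots,C_n\}$ of $\mathbb{R}^d$ by closed convex sets (possibly unbounded, with nonempty interior) whose interiors are pairwise disjoint. A hyperplane means an affine hyperplane. A hyperplane $H$ avoids a set $C$ if $H$ does not intersect the interior of $C$. *)

theory Defs
  imports "HOL-Analysis.Analysis"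
begin

definition nice_measure :: "'a::euclidean_space measure \<Rightarrow> bool" where
  "nice_measure \<mu> \<longleftrightarrow>
     finite_measure \<mu> \<and> sets \<mu> = sets borel \<and> emeasure \<mu> (space \<mu>) \<noteq> 0 \<and>
     (\<exists>f :: 'a \<Rightarrow> real. continuous_on UNIV f \<and> (\<forall>x. f x > 0) \<and>
        \<mu> = density lborel (\<lambda>x. ennreal (f x)))"

text \<open>
  A set of parts suffices: parts with nonempty and pairwise disjoint interiors are automatically
  distinct, so an indexed covering by \<open>n\<close> parts is the same as a set of cardinality \<open>n\<close>.
\<close>

definition convex_partition :: "nat \<Rightarrow> 'a::euclidean_space set set \<Rightarrow> bool" where
  "convex_partition n P \<longleftrightarrow>
     finite P \<and> card P = n \<and> \<Union>P = UNIV \<and>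
     (\<forall>C\<in>P. closed C \<and> convex C \<and> interior C \<noteq> {}) \<and>
     (\<forall>C\<in>P. \<forall>D\<in>P. C \<noteq> D \<longrightarrow> interior C \<inter> interior D = {})"

definition hyperplane :: "'a::euclidean_space set \<Rightarrow> bool" where
  "hyperplane H \<longleftrightarrow> (\<exists>a b. a \<noteq> 0 \<and> H = {x. a \<bullet> x = b})"

definition avoids :: "'a::euclidean_space set \<Rightarrow> 'a set \<Rightarrow> bool" where
  "avoids H C \<longleftrightarrow> H \<inter> interior C = {}"

end

theory Submission
  imports Defs
begin

text \<open>
  The proof separates one coordinate \<open>b\<close>, called vertical, from the set \<open>B\<close> of the others.  The
  classical construction of Yao and Yao cuts space into \<open>2 ^ card B\<close> closed convex cylinders (cells) of
  equal measure, with walls parallel to \<open>b\<close>.  Together with the cells comes a family of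
  piecewise affine graphs: on each cell a graph is an affine function of the coordinates in \<open>B\<close>, and
  the pieces on different cells are linked by a common tree of slopes.  The links are chosen to
  serve two opposite purposes.

  The first purpose is rigidity (\<open>one_sided\<close>): any affine function \<open>m\<close> of the coordinates in \<open>B\<close>
  stays on one side of a given graph over at least one whole cell.  The second is flexibility
  (\<open>solve\<close>): there is one degree of freedom per cell, so a graph can be found
  that cuts off a prescribed fraction of the mass in every cell simultaneously.  Both are proved by
  adding one coordinate at a time (\<open>yao_yao_insert\<close>); for flexibility the mass condition is encoded by an
  abstract quantile functional on each cell, and the functionals of two sibling cells are merged into
  one for their parent by the intermediate value theorem (\<open>quantile_like_combine\<close>).

  Given this, let \<open>G1\<close> be a graph with a third of every cell below it, and let \<open>G2\<close> be a graph that
  bisects, in every cell, what lies above \<open>G1\<close>.  The two graphs may cross.  Cutting each cell along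
  \<open>G1\<close>, and then only its upper piece along \<open>G2\<close>, gives three convex parts of equal measure.  A
  hyperplane that is not parallel to \<open>b\<close> is the graph of some \<open>m\<close>.  If \<open>m \<le> G1\<close> on a cell, the two upper
  parts of that cell are avoided.  Otherwise \<open>m \<ge> G1\<close> on some cell, whose bottom part is avoided; moreover,
  \<open>m\<close> stays on one side of \<open>G2\<close> on some cell, where one of the two upper parts is avoided.  A hyperplane
  parallel to \<open>b\<close> leaves a whole cell on one side, by comparison with the graph \<open>0\<close>, and so avoids the
  three parts of that cell.
\<close>

section \<open>Affine functions\<close>

text \<open>
  Affine functions are stored as pairs (linear part, constant), so that they form a Euclidean space and
  continuity in the function makes sense.
\<close>

definition ev :: "'a::euclidean_space \<times> real \<Rightarrow> 'a \<Rightarrow> real" where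
  "ev f x = fst f \<bullet> x + snd f"

lemma ev_simps [simp]:
  "ev (f + g) x = ev f x + ev g x"
  "ev (f - g) x = ev f x - ev g x"
  "ev (- f) x = - ev f x"
  "ev (c *\<^sub>R f) x = c * ev f x"
  "ev 0 x = 0"
  "ev (0, c) x = c"
  by (simp_all add: ev_def algebra_simps)

lemma continuous_on_ev [continuous_intros]: "continuous_on S (ev f)"
  unfolding ev_def by (intro continuous_intros)

lemma closed_ev_le [simp]: "closed {x. ev f x \<le> q}" "closed {x. q \<le> ev f x}"
  by (intro closed_Collect_le continuous_intros)+

lemma open_ev_less [simp]: "open {x. ev f x < q}" "open {x. q < ev f x}"
  by (intro open_Collect_less continuous_intros)+

lemma convex_ev_le [simp]: "convex {x. ev f x \<le> q}" "convex {x. q \<le> ev f x}"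
proof -
  have "{x. ev f x \<le> q} = {x. fst f \<bullet> x \<le> q - snd f}" "{x. q \<le> ev f x} = {x. fst f \<bullet> x \<ge> q - snd f}"
    by (auto simp: ev_def algebra_simps)
  then show "convex {x. ev f x \<le> q}" "convex {x. q \<le> ev f x}"
    by (simp_all add: convex_halfspace_le convex_halfspace_ge)
qed

lemma negligible_ev_eq: "fst f \<noteq> 0 \<Longrightarrow> negligible {x. ev f x = q}"
proof -
  assume "fst f \<noteq> 0"
  moreover have "{x. ev f x = q} = {x. fst f \<bullet> x = q - snd f}" by (auto simp: ev_def algebra_simps)
  ultimately show ?thesis by (simp add: negligible_hyperplane)
qed

lemma ev_pos_on_interior:
  assumes "fst f \<noteq> 0" "\<And>x. x \<in> S \<Longrightarrow> 0 \<le> ev f x" "x \<in> interior S"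
  shows "0 < ev f x"
proof -
  have "interior S \<subseteq> interior {x. fst f \<bullet> x \<ge> - snd f}"
    using assms(2) by (intro interior_mono) (force simp: ev_def)
  with assms(1,3) show ?thesis
    by (auto simp: interior_halfspace_ge ev_def)
qed

text \<open>
  Nearby affine functions are uniformly close on a ball.  Truncating to balls is how continuity of
  quantiles is obtained on unbounded sets.
\<close>

lemma abs_ev_diff_le:
  assumes "norm x \<le> R" "1 \<le> R"
  shows "\<bar>ev g x - ev f x\<bar> \<le> 2 * R * dist g f"
proof -
  have "\<bar>ev g x - ev f x\<bar> \<le> \<bar>fst (g - f) \<bullet> x\<bar> + \<bar>snd (g - f)\<bar>"
    by (simp add: ev_def algebra_simps)
  also have "\<dots> \<le> norm (fst (g - f)) * norm x + norm (snd (g - f))"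
    using Cauchy_Schwarz_ineq2[of "fst (g - f)" x] by (simp only: real_norm_def)
  also have "\<dots> \<le> norm (g - f) * R + norm (g - f) * R"
  proof (intro add_mono mult_mono)
    show "norm (fst (g - f)) \<le> norm (g - f)"
      using norm_fst_le[of "fst (g - f)" "snd (g - f)"] by (simp only: prod.collapse)
    have "norm (snd (g - f)) \<le> norm (g - f) * 1"
      using norm_snd_le[of "snd (g - f)" "fst (g - f)"] by (simp only: prod.collapse mult_1_right)
    also have "\<dots> \<le> norm (g - f) * R" using assms by (intro mult_left_mono) auto
    finally show "norm (snd (g - f)) \<le> norm (g - f) * R" .
  qed (use assms in auto)
  finally show ?thesis by (simp add: dist_norm algebra_simps)
qed

lemma inverse_Suc_antimono: "1 / real (Suc (Suc k)) \<le> 1 / real (Suc k)"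
  by (intro divide_left_mono) auto

section \<open>Functionals that behave like quantiles\<close>

text \<open>
  What the construction needs to know about the map that sends an affine function to the quantile of
  its values on \<open>C\<close>.  The last clause says that tilting the function by a large multiple of some
  \<open>Y\<close> that is positive inside \<open>C\<close> drives the value to plus or minus infinity; it makes sign changes available for the
  intermediate value theorem.  All four clauses survive merging two cells, unlike the statement that a
  given fraction of mass lies below the value.
\<close>

definition quantile_like :: "'a::euclidean_space set \<Rightarrow> ('a \<times> real \<Rightarrow> real) \<Rightarrow> bool" where
  "quantile_like C \<Phi> \<longleftrightarrow>
     (\<forall>f c. \<Phi> (f + (0, c)) = \<Phi> f + c) \<and>
     (\<forall>f g. (\<forall>x\<in>C. ev f x \<le> ev g x) \<longrightarrow> \<Phi> f \<le> \<Phi> g) \<and>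
     continuous_on UNIV \<Phi> \<and>
     (\<forall>f Y M. (\<forall>x\<in>C. 0 \<le> ev Y x) \<longrightarrow> (\<forall>x\<in>interior C. 0 < ev Y x) \<longrightarrow>
        (\<exists>a0. \<forall>a\<ge>a0. \<Phi> (f - a *\<^sub>R Y) \<le> M \<and> M \<le> \<Phi> (f + a *\<^sub>R Y)))"

lemma quantile_likeD:
  assumes "quantile_like C \<Phi>"
  shows "\<Phi> (f + (0, c)) = \<Phi> f + c"
    and "(\<And>x. x \<in> C \<Longrightarrow> ev f x \<le> ev g x) \<Longrightarrow> \<Phi> f \<le> \<Phi> g"
    and "continuous_on UNIV \<Phi>"
    and "(\<And>x. x \<in> C \<Longrightarrow> 0 \<le> ev Y x) \<Longrightarrow> (\<And>x. x \<in> interior C \<Longrightarrow> 0 < ev Y x) \<Longrightarrow>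
         \<exists>a0. \<forall>a\<ge>a0. \<Phi> (f - a *\<^sub>R Y) \<le> M \<and> M \<le> \<Phi> (f + a *\<^sub>R Y)"
  using assms unfolding quantile_like_def by blast+

text \<open>
  A quantile taken over a subset only is still an admissible functional for the whole cell.  The
  second of the two cuts uses this, as it bisects only the upper piece of each cell.
\<close>

lemma quantile_like_mono:
  assumes "quantile_like D \<Phi>" "D \<subseteq> C"
  shows "quantile_like C \<Phi>"
  unfolding quantile_like_def
proof (intro conjI allI impI)
  note d = quantile_likeD[OF assms(1)]
  show "\<Phi> (f + (0, c)) = \<Phi> f + c" for f c by (rule d)
  show "\<Phi> f \<le> \<Phi> g" if "\<forall>x\<in>C. ev f x \<le> ev g x" for f g
    using that assms(2) by (intro d(2)) auto
  show "continuous_on UNIV \<Phi>" by (rule d)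
  show "\<exists>a0. \<forall>a\<ge>a0. \<Phi> (f - a *\<^sub>R Y) \<le> M \<and> M \<le> \<Phi> (f + a *\<^sub>R Y)"
    if "\<forall>x\<in>C. 0 \<le> ev Y x" "\<forall>x\<in>interior C. 0 < ev Y x" for f Y M
    using that assms(2) interior_mono[OF assms(2)] by (intro d(4)) auto
qed

text \<open>
  Subtracting \<open>a *\<^sub>R Y\<close> from \<open>f\<close> lowers the value on the positive side of \<open>Y\<close> and raises it on the
  negative side as \<open>a\<close> grows, so the two values cross.  The slope \<open>a\<close> at the crossing need not be
  unique, but the common value is: for any \<open>a\<close> whatsoever it lies between the two values for \<open>a\<close>.
  This sandwich yields all the required properties of the common value, continuity included, without
  control over how \<open>a\<close> depends on \<open>f\<close>.
\<close>

lemma quantile_like_combine: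
  fixes Y :: "'a::euclidean_space \<times> real"
  assumes q1: "quantile_like (C \<inter> {x. 0 \<le> ev Y x}) \<Phi>1"
    and q2: "quantile_like (C \<inter> {x. ev Y x \<le> 0}) \<Phi>2"
    and Y: "fst Y \<noteq> 0"
  obtains \<Phi> where "quantile_like C \<Phi>"
    and "\<And>f. \<exists>a. \<Phi>1 (f - a *\<^sub>R Y) = \<Phi> f \<and> \<Phi>2 (f - a *\<^sub>R Y) = \<Phi> f"
proof -
  note d1 = quantile_likeD[OF q1] and d2 = quantile_likeD[OF q2]
  have m1: "\<Phi>1 (f - b *\<^sub>R Y) \<le> \<Phi>1 (f - a *\<^sub>R Y)" if "a \<le> b" for f a b
    using that by (intro d1(2)) (auto intro: mult_right_mono)
  have m2: "\<Phi>2 (f - a *\<^sub>R Y) \<le> \<Phi>2 (f - b *\<^sub>R Y)" if "a \<le> b" for f a b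
    using that by (intro d2(2)) (auto intro: mult_right_mono_neg)
  have Yp: "0 < ev Y x" if "x \<in> interior (C \<inter> {x. 0 \<le> ev Y x})" for x
    using that by (rule ev_pos_on_interior[OF Y, rotated]) auto
  have Yn: "0 < ev (- Y) x" if "x \<in> interior (C \<inter> {x. ev Y x \<le> 0})" for x
    using that by (rule ev_pos_on_interior[rotated 2]) (use Y in auto)
  have crossing: "\<exists>a. \<Phi>1 (f - a *\<^sub>R Y) = \<Phi>2 (f - a *\<^sub>R Y)" for f
  proof -
    define h where "h a = \<Phi>1 (f - a *\<^sub>R Y) - \<Phi>2 (f - a *\<^sub>R Y)" for a
    have "\<exists>a0. \<forall>a\<ge>a0. \<Phi>1 (f - a *\<^sub>R Y) \<le> \<Phi>2 f \<and> \<Phi>2 f \<le> \<Phi>1 (f + a *\<^sub>R Y)"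
      using Yp by (intro d1(4)) auto
    then obtain a0 where a0: "\<And>a. a \<ge> a0 \<Longrightarrow> \<Phi>1 (f - a *\<^sub>R Y) \<le> \<Phi>2 f \<and> \<Phi>2 f \<le> \<Phi>1 (f + a *\<^sub>R Y)"
      by blast
    define a where "a = max a0 0"
    have "h a \<le> 0"
      using a0[of a] m2[of 0 a f] by (simp add: h_def a_def)
    moreover have "0 \<le> h (- a)"
      using a0[of a] m2[of "- a" 0 f] by (simp add: h_def a_def)
    moreover have "continuous_on {- a..a} h"
      unfolding h_def
      by (intro continuous_intros continuous_on_compose2[OF d1(3)] continuous_on_compose2[OF d2(3)]) auto
    moreover have "- a \<le> a" by (simp add: a_def)
    ultimately have "\<exists>x. - a \<le> x \<and> x \<le> a \<and> h x = 0"
      by (intro IVT2') auto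
    then show ?thesis by (auto simp: h_def)
  qed
  then obtain s where s: "\<And>f. \<Phi>1 (f - s f *\<^sub>R Y) = \<Phi>2 (f - s f *\<^sub>R Y)" by metis
  define \<Phi> where "\<Phi> f = \<Phi>1 (f - s f *\<^sub>R Y)" for f
  have P1: "\<Phi>1 (f - s f *\<^sub>R Y) = \<Phi> f" and P2: "\<Phi>2 (f - s f *\<^sub>R Y) = \<Phi> f" for f
    using s by (auto simp: \<Phi>_def)
  \<comment> \<open>The sandwich: arbitrary slopes bound the common value from both sides.\<close>
  have lo: "min (\<Phi>1 (f - a *\<^sub>R Y)) (\<Phi>2 (f - a *\<^sub>R Y)) \<le> \<Phi> f" for f a
    using m1[of "s f" a f] m2[of a "s f" f] P1[of f] P2[of f] by linarith
  have hi: "\<Phi> f \<le> max (\<Phi>1 (f - a *\<^sub>R Y)) (\<Phi>2 (f - a *\<^sub>R Y))" for f a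
    using m1[of a "s f" f] m2[of "s f" a f] P1[of f] P2[of f] by linarith
  have "quantile_like C \<Phi>"
    unfolding quantile_like_def
  proof (intro conjI allI impI)
    fix f :: "'a \<times> real" and c
    have e: "f + (0, c) - s f *\<^sub>R Y = (f - s f *\<^sub>R Y) + (0, c)" by simp
    show "\<Phi> (f + (0, c)) = \<Phi> f + c"
      using lo[of "f + (0, c)" "s f"] hi[of "f + (0, c)" "s f"]
      unfolding e d1(1) d2(1) P1 P2 by simp
  next
    fix f g :: "'a \<times> real"
    assume le: "\<forall>x\<in>C. ev f x \<le> ev g x"
    have "\<Phi>1 (f - s f *\<^sub>R Y) \<le> \<Phi>1 (g - s f *\<^sub>R Y)" "\<Phi>2 (f - s f *\<^sub>R Y) \<le> \<Phi>2 (g - s f *\<^sub>R Y)"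
      using le by (auto intro!: d1(2) d2(2))
    then show "\<Phi> f \<le> \<Phi> g"
      using lo[of g "s f"] P1[of f] P2[of f] by linarith
  next
    show "continuous_on UNIV \<Phi>"
      unfolding continuous_on_def
    proof
      fix f :: "'a \<times> real"
      have t: "((\<lambda>g. \<Phi>1 (g - s f *\<^sub>R Y)) \<longlongrightarrow> \<Phi> f) (at f)" "((\<lambda>g. \<Phi>2 (g - s f *\<^sub>R Y)) \<longlongrightarrow> \<Phi> f) (at f)"
      proof -
        have "continuous_on UNIV (\<lambda>g. \<Phi>1 (g - s f *\<^sub>R Y))" "continuous_on UNIV (\<lambda>g. \<Phi>2 (g - s f *\<^sub>R Y))"
          by (intro continuous_intros continuous_on_compose2[OF d1(3)] continuous_on_compose2[OF d2(3)]; auto)+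
        then show "((\<lambda>g. \<Phi>1 (g - s f *\<^sub>R Y)) \<longlongrightarrow> \<Phi> f) (at f)" "((\<lambda>g. \<Phi>2 (g - s f *\<^sub>R Y)) \<longlongrightarrow> \<Phi> f) (at f)"
          using P1[of f] P2[of f] unfolding continuous_on_def by (metis UNIV_I)+
      qed
      show "(\<Phi> \<longlongrightarrow> \<Phi> f) (at f)"
      proof (rule tendsto_sandwich)
        show "\<forall>\<^sub>F g in at f. min (\<Phi>1 (g - s f *\<^sub>R Y)) (\<Phi>2 (g - s f *\<^sub>R Y)) \<le> \<Phi> g"
          using lo by auto
        show "\<forall>\<^sub>F g in at f. \<Phi> g \<le> max (\<Phi>1 (g - s f *\<^sub>R Y)) (\<Phi>2 (g - s f *\<^sub>R Y))"
          using hi by auto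
        show "((\<lambda>g. min (\<Phi>1 (g - s f *\<^sub>R Y)) (\<Phi>2 (g - s f *\<^sub>R Y))) \<longlongrightarrow> \<Phi> f) (at f)"
          using tendsto_min[OF t] by simp
        show "((\<lambda>g. max (\<Phi>1 (g - s f *\<^sub>R Y)) (\<Phi>2 (g - s f *\<^sub>R Y))) \<longlongrightarrow> \<Phi> f) (at f)"
          using tendsto_max[OF t] by simp
      qed
    qed
  next
    fix f Z :: "'a \<times> real" and M
    assume Z: "\<forall>x\<in>C. 0 \<le> ev Z x" "\<forall>x\<in>interior C. 0 < ev Z x"
    have "\<exists>a0. \<forall>a\<ge>a0. \<Phi>1 (f - a *\<^sub>R Z) \<le> M \<and> M \<le> \<Phi>1 (f + a *\<^sub>R Z)"
      using Z by (intro d1(4)) auto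
    moreover have "\<exists>a0. \<forall>a\<ge>a0. \<Phi>2 (f - a *\<^sub>R Z) \<le> M \<and> M \<le> \<Phi>2 (f + a *\<^sub>R Z)"
      using Z by (intro d2(4)) auto
    ultimately obtain a1 a2 where a12:
      "\<And>a. a \<ge> a1 \<Longrightarrow> \<Phi>1 (f - a *\<^sub>R Z) \<le> M \<and> M \<le> \<Phi>1 (f + a *\<^sub>R Z)"
      "\<And>a. a \<ge> a2 \<Longrightarrow> \<Phi>2 (f - a *\<^sub>R Z) \<le> M \<and> M \<le> \<Phi>2 (f + a *\<^sub>R Z)" by blast
    have "\<Phi> (f - a *\<^sub>R Z) \<le> M \<and> M \<le> \<Phi> (f + a *\<^sub>R Z)" if "a \<ge> max a1 a2" for a
      using hi[of "f - a *\<^sub>R Z" 0] lo[of "f + a *\<^sub>R Z" 0] a12[of a] that by auto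
    then show "\<exists>a0. \<forall>a\<ge>a0. \<Phi> (f - a *\<^sub>R Z) \<le> M \<and> M \<le> \<Phi> (f + a *\<^sub>R Z)" by blast
  qed
  then show ?thesis
  proof (rule that)
    show "\<exists>a. \<Phi>1 (f - a *\<^sub>R Y) = \<Phi> f \<and> \<Phi>2 (f - a *\<^sub>R Y) = \<Phi> f" for f
      using P1[of f] P2[of f] by (intro exI[of _ "s f"] conjI)
  qed
qed

section \<open>Quantiles of affine functions\<close>

text \<open>
  Continuity and positivity of the density enter the proof only through these properties.
\<close>

locale full_support_measure = finite_measure \<mu> for \<mu> :: "'a::euclidean_space measure" +
  assumes sets_borel: "sets \<mu> = sets borel"
    and measure_eq_0_iff: "A \<in> sets borel \<Longrightarrow> measure \<mu> A = 0 \<longleftrightarrow> negligible A"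
begin

lemma measurable_closed [simp]: "closed A \<Longrightarrow> A \<in> sets \<mu>"
  and measurable_open [simp]: "open A \<Longrightarrow> A \<in> sets \<mu>"
  by (simp_all add: sets_borel)

lemma interior_nonempty_if_measure_pos:
  assumes "closed C" "convex C" "0 < measure \<mu> C"
  shows "interior C \<noteq> {}"
  using assms measure_eq_0_iff[of C] negligible_convex_interior[of C] by (auto simp: sets_borel)

lemma measure_open_pos: "open U \<Longrightarrow> U \<noteq> {} \<Longrightarrow> 0 < measure \<mu> U"
  using measure_eq_0_iff[of U] open_not_negligible[of U] by (auto simp: zero_less_measure_iff)

lemma measure_split:
  assumes "closed D"
  shows "measure \<mu> D = measure \<mu> (D \<inter> {x. ev f x \<le> q}) + measure \<mu> (D \<inter> {x. q < ev f x})"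
proof -
  have "D = (D \<inter> {x. ev f x \<le> q}) \<union> (D \<inter> {x. q < ev f x})" by auto
  moreover have "measure \<mu> ((D \<inter> {x. ev f x \<le> q}) \<union> (D \<inter> {x. q < ev f x})) =
     measure \<mu> (D \<inter> {x. ev f x \<le> q}) + measure \<mu> (D \<inter> {x. q < ev f x})"
    using assms by (intro finite_measure_Union) auto
  ultimately show ?thesis by simp
qed

lemma measure_split_closed:
  assumes "closed D" "fst f \<noteq> 0"
  shows "measure \<mu> D = measure \<mu> (D \<inter> {x. ev f x \<le> q}) + measure \<mu> (D \<inter> {x. q \<le> ev f x})"
proof -
  have 1: "D \<inter> {x. q \<le> ev f x} = (D \<inter> {x. q < ev f x}) \<union> (D \<inter> {x. q \<le> ev f x} \<inter> {x. ev f x \<le> q})" by auto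
  have "negligible (D \<inter> {x. q \<le> ev f x} \<inter> {x. ev f x \<le> q})"
    by (rule negligible_subset[OF negligible_ev_eq[OF assms(2), of q]]) auto
  moreover have m: "D \<inter> {x. q \<le> ev f x} \<inter> {x. ev f x \<le> q} \<in> sets \<mu>"
    using assms(1) by (intro measurable_closed closed_Int) auto
  ultimately have 0: "measure \<mu> (D \<inter> {x. q \<le> ev f x} \<inter> {x. ev f x \<le> q}) = 0"
    using assms(1) by (subst measure_eq_0_iff) auto
  have "measure \<mu> (D \<inter> {x. q \<le> ev f x}) = measure \<mu> (D \<inter> {x. q < ev f x})"
    by (subst 1, subst finite_measure_Union) (use assms(1) 0 m in auto)
  with measure_split[OF assms(1), of f q] show ?thesis by simp
qed

text \<open>
  The form in which continuity of the measure is used below: a strict lower bound for the measure of a set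
  already holds for some member of any sequence that exhausts it.
\<close>

lemma exhaustion:
  assumes "\<And>k. A k \<in> sets \<mu>" "incseq A" "B \<subseteq> (\<Union>k. A k)" "B \<in> sets \<mu>" "r < measure \<mu> B"
  shows "\<exists>k::nat. r < measure \<mu> (A k)"
proof -
  have "(\<lambda>k. measure \<mu> (A k)) \<longlonglongrightarrow> measure \<mu> (\<Union>k. A k)"
    using assms by (intro finite_Lim_measure_incseq) auto
  moreover have "r < measure \<mu> (\<Union>k. A k)"
    using assms finite_measure_mono[of B "\<Union>k. A k"] by (simp add: sets.countable_UN' )
  ultimately have "eventually (\<lambda>k. r < measure \<mu> (A k)) sequentially"
    by (rule order_tendstoD)
  then show ?thesis by (auto simp: eventually_sequentially)
qed

definition reaches :: "'a set \<Rightarrow> real \<Rightarrow> 'a \<times> real \<Rightarrow> real \<Rightarrow> bool" where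
  "reaches D p f q \<longleftrightarrow> p * measure \<mu> D \<le> measure \<mu> (D \<inter> {x. ev f x \<le> q})"

definition quantile :: "'a set \<Rightarrow> real \<Rightarrow> 'a \<times> real \<Rightarrow> real" where
  "quantile D p f = Inf {q. reaches D p f q}"

end

locale body = full_support_measure +
  fixes D :: "'a set" and p :: real
  assumes D: "closed D" "convex D" "0 < measure \<mu> D"
    and p: "0 < p" "p < 1"
begin

lemma interior_D: "interior D \<noteq> {}"
  using D by (rule interior_nonempty_if_measure_pos)

lemma reaches_mono: "reaches D p f q \<Longrightarrow> q \<le> r \<Longrightarrow> reaches D p f r"
  unfolding reaches_def using D(1)
  by (erule_tac order_trans) (intro finite_measure_mono, auto)

lemma reaches_ex: "\<exists>q. reaches D p f q"
proof -
  have "\<exists>k::nat. p * measure \<mu> D < measure \<mu> (D \<inter> {x. ev f x \<le> real k})"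
    by (rule exhaustion[of _ D])
      (use D p real_arch_simple in \<open>auto simp: incseq_def\<close>)
  then show ?thesis unfolding reaches_def using less_imp_le by blast
qed

lemma not_reaches_ex:
  assumes "\<not> reaches D p f q"
  shows "\<exists>r>q. \<not> reaches D p f r"
proof -
  have "measure \<mu> D - p * measure \<mu> D < measure \<mu> (D \<inter> {x. q < ev f x})"
    using measure_split[OF D(1), of f q] assms by (simp add: reaches_def)
  then have "\<exists>k::nat. measure \<mu> D - p * measure \<mu> D < measure \<mu> (D \<inter> {x. q + 1 / Suc k < ev f x})"
  proof (rule exhaustion[rotated 4])
    show "incseq (\<lambda>k. D \<inter> {x. q + 1 / real (Suc k) < ev f x})"
    proof (rule incseq_SucI, safe)
      fix k x assume "q + 1 / real (Suc k) < ev f x"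
      then show "q + 1 / real (Suc (Suc k)) < ev f x"
        using inverse_Suc_antimono[of k] by linarith
    qed
    show "D \<inter> {x. q < ev f x} \<subseteq> (\<Union>k. D \<inter> {x. q + 1 / real (Suc k) < ev f x})"
    proof
      fix x assume x: "x \<in> D \<inter> {x. q < ev f x}"
      then obtain k where "1 / real (Suc k) < ev f x - q"
        using reals_Archimedean[of "ev f x - q"] by (auto simp: inverse_eq_divide)
      with x show "x \<in> (\<Union>k. D \<inter> {x. q + 1 / real (Suc k) < ev f x})"
        by (auto intro!: exI[of _ k])
    qed
  qed (use D in auto)
  then obtain k :: nat where "measure \<mu> D - p * measure \<mu> D < measure \<mu> (D \<inter> {x. q + 1 / Suc k < ev f x})" ..
  then have "\<not> reaches D p f (q + 1 / Suc k)"
    using measure_split[OF D(1), of f "q + 1 / Suc k"] by (simp add: reaches_def)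
  then show ?thesis by (intro exI[of _ "q + 1 / Suc k"]) auto
qed

lemma not_reaches_low: "\<exists>q. \<not> reaches D p f q"
proof -
  have "\<exists>k::nat. measure \<mu> D - p * measure \<mu> D < measure \<mu> (D \<inter> {x. - real k < ev f x})"
  proof (rule exhaustion[of _ D])
    show "D \<subseteq> (\<Union>k. D \<inter> {x. - real k < ev f x})"
    proof
      fix x assume "x \<in> D"
      moreover obtain k where "- ev f x < real k" using reals_Archimedean2 by blast
      ultimately show "x \<in> (\<Union>k. D \<inter> {x. - real k < ev f x})" by (auto intro!: exI[of _ k])
    qed
  qed (use D p in \<open>auto simp: incseq_def\<close>)
  then obtain k :: nat where "measure \<mu> D - p * measure \<mu> D < measure \<mu> (D \<inter> {x. - real k < ev f x})" ..
  then have "\<not> reaches D p f (- real k)"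
    using measure_split[OF D(1), of f "- real k"] by (simp add: reaches_def)
  then show ?thesis ..
qed

text \<open>
  The set of levels that are reached is a closed half-line: by continuity from above of the measure, a
  level that is missed leaves room above it.
\<close>

lemma quantile_le_iff: "quantile D p f \<le> q \<longleftrightarrow> reaches D p f q"
proof
  obtain q0 where q0: "\<not> reaches D p f q0" using not_reaches_low by blast
  have bdd: "bdd_below {q. reaches D p f q}"
    using q0 reaches_mono[of f _ q0] by (intro bdd_belowI[of _ q0]) (metis linear mem_Collect_eq)
  show "quantile D p f \<le> q" if "reaches D p f q"
    unfolding quantile_def using that bdd by (intro cInf_lower) auto
  show "reaches D p f q" if "quantile D p f \<le> q"
  proof (rule ccontr)
    assume "\<not> reaches D p f q"
    then obtain r where r: "r > q" "\<not> reaches D p f r" using not_reaches_ex by blast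
    have "r \<le> quantile D p f"
      unfolding quantile_def
    proof (rule cInf_greatest)
      show "{q. reaches D p f q} \<noteq> {}" using reaches_ex by auto
      show "r \<le> x" if "x \<in> {q. reaches D p f q}" for x
        using that r(2) reaches_mono[of f x r] by force
    qed
    with that r show False by simp
  qed
qed

text \<open>
  Quantiles are unique.  If the level \<open>q0\<close> had exactly the fraction \<open>p\<close> of the mass below it, then by convexity \<open>f\<close> takes
  values between \<open>q0\<close> and \<open>q\<close> on \<open>D\<close>, hence on an open subset of \<open>D\<close>, which has positive measure.
\<close>

lemma strictly_above_quantile:
  assumes q: "quantile D p f < q"
  shows "p * measure \<mu> D < measure \<mu> (D \<inter> {x. ev f x < q})"
proof -
  define q0 where "q0 = quantile D p f"
  have q0: "p * measure \<mu> D \<le> measure \<mu> (D \<inter> {x. ev f x \<le> q0})"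
    using quantile_le_iff[of f q0] by (simp add: q0_def reaches_def)
  have sub: "measure \<mu> (D \<inter> {x. ev f x \<le> q0}) \<le> measure \<mu> (D \<inter> {x. ev f x < q})"
    using D q by (intro finite_measure_mono) (auto simp: q0_def)
  show ?thesis
  proof (cases "p * measure \<mu> D < measure \<mu> (D \<inter> {x. ev f x \<le> q0})")
    case True then show ?thesis using sub by simp
  next
    case False
    then have eq: "measure \<mu> (D \<inter> {x. ev f x \<le> q0}) = p * measure \<mu> D" using q0 by simp
    have "0 < p * measure \<mu> D" "p * measure \<mu> D < 1 * measure \<mu> D"
      using p D by (auto intro: mult_strict_right_mono)
    then have pos: "0 < measure \<mu> (D \<inter> {x. ev f x \<le> q0})" "0 < measure \<mu> (D \<inter> {x. q0 < ev f x})"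
      using eq measure_split[OF D(1), of f q0] by linarith+
    then have ne: "D \<inter> {x. ev f x \<le> q0} \<noteq> {}" "D \<inter> {x. q0 < ev f x} \<noteq> {}"
      by (auto simp del: Int_iff)
    then obtain x y where xy: "x \<in> D" "ev f x \<le> q0" "y \<in> D" "q0 < ev f y" by blast
    have conn: "connected (ev f ` D)"
      using convex_connected[OF D(2)] by (intro connected_continuous_image continuous_intros)
    define t where "t = min (ev f y) ((q0 + q) / 2)"
    have "q0 < q" using q by (simp add: q0_def)
    then have t: "q0 < t" "t < q" "t \<le> ev f y" "ev f x \<le> t"
      using xy(2,4) by (auto simp: t_def min_def)
    have "t \<in> ev f ` D"
      using connectedD_interval[OF conn, of "ev f x" "ev f y" t] xy t by auto
    then obtain z where z: "z \<in> D" "ev f z = t" by auto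
    define U where "U = {x. q0 < ev f x} \<inter> {x. ev f x < q}"
    have "z \<in> closure (interior D)"
      using convex_closure_interior[OF D(2) interior_D] z(1) closure_subset by blast
    moreover have "open U" "z \<in> U" using z t by (auto simp: U_def)
    ultimately have "interior D \<inter> U \<noteq> {}"
      by (meson closure_iff_nhds_not_empty interior_open disjoint_iff order_refl)
    then have "0 < measure \<mu> (interior D \<inter> U)"
      using \<open>open U\<close> by (intro measure_open_pos) auto
    moreover have "measure \<mu> (D \<inter> {x. ev f x \<le> q0}) + measure \<mu> (interior D \<inter> U)
        = measure \<mu> ((D \<inter> {x. ev f x \<le> q0}) \<union> (interior D \<inter> U))"
      using D \<open>open U\<close> by (intro finite_measure_Union[symmetric]) (auto simp: U_def)
    moreover have "\<dots> \<le> measure \<mu> (D \<inter> {x. ev f x < q})"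
      using D q interior_subset[of D] by (intro finite_measure_mono) (auto simp: U_def q0_def)
    ultimately show ?thesis using eq by linarith
  qed
qed

text \<open>
  By uniqueness, reflection exchanges the quantiles \<open>p\<close> and \<open>1 - p\<close>; each one-sided estimate below therefore
  also gives its mirror image.
\<close>

lemma quantile_uminus: "quantile D (1 - p) (- f) = - quantile D p f"
proof -
  have *: "reaches D (1 - p) (- f) r \<longleftrightarrow> - r \<le> quantile D p f" for r
  proof -
    have s: "{x. - r \<le> ev f x} = {x. ev (- f) x \<le> r}" "{x. r < ev (-f) x} = {x. ev f x < - r}" by auto
    have "reaches D (1 - p) (- f) r \<longleftrightarrow> measure \<mu> (D \<inter> {x. ev f x < - r}) \<le> p * measure \<mu> D"
      using measure_split[OF D(1), of "- f" r] unfolding reaches_def s by (auto simp: algebra_simps)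
    also have "\<dots> \<longleftrightarrow> - r \<le> quantile D p f"
    proof
      show "- r \<le> quantile D p f" if "measure \<mu> (D \<inter> {x. ev f x < - r}) \<le> p * measure \<mu> D"
        using that strictly_above_quantile[of f "- r"] by force
      show "measure \<mu> (D \<inter> {x. ev f x < - r}) \<le> p * measure \<mu> D" if le: "- r \<le> quantile D p f"
      proof (rule ccontr)
        assume "\<not> measure \<mu> (D \<inter> {x. ev f x < - r}) \<le> p * measure \<mu> D"
        then have "p * measure \<mu> D < measure \<mu> (D \<inter> {x. ev f x < - r})" by simp
        then have "\<exists>k::nat. p * measure \<mu> D < measure \<mu> (D \<inter> {x. ev f x \<le> - r - 1 / Suc k})"
        proof (rule exhaustion[rotated 4])
          show "incseq (\<lambda>k. D \<inter> {x. ev f x \<le> - r - 1 / real (Suc k)})"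
          proof (rule incseq_SucI, safe)
            fix k x assume "ev f x \<le> - r - 1 / real (Suc k)"
            then show "ev f x \<le> - r - 1 / real (Suc (Suc k))"
              using inverse_Suc_antimono[of k] by linarith
          qed
          show "D \<inter> {x. ev f x < - r} \<subseteq> (\<Union>k. D \<inter> {x. ev f x \<le> - r - 1 / real (Suc k)})"
          proof
            fix x assume x: "x \<in> D \<inter> {x. ev f x < - r}"
            then obtain k where "1 / real (Suc k) < - r - ev f x"
              using reals_Archimedean[of "- r - ev f x"] by (auto simp: inverse_eq_divide)
            with x show "x \<in> (\<Union>k. D \<inter> {x. ev f x \<le> - r - 1 / real (Suc k)})"
              by (auto intro!: exI[of _ k])
          qed
        qed (use D in auto)
        then obtain k :: nat where "p * measure \<mu> D < measure \<mu> (D \<inter> {x. ev f x \<le> - r - 1 / Suc k})" ..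
        then have "quantile D p f \<le> - r - 1 / Suc k"
          by (subst quantile_le_iff) (simp add: reaches_def)
        moreover have "0 < 1 / real (Suc k)" by simp
        ultimately show False using le by linarith
      qed
    qed
    finally show ?thesis .
  qed
  have "{r. reaches D (1 - p) (- f) r} = {- quantile D p f..}"
    unfolding * by auto
  then show ?thesis by (simp add: quantile_def[of D "1 - p"])
qed

text \<open>
  Upper semicontinuity: the mass strictly below \<open>q\<close> exceeds the fraction \<open>p\<close> already on a bounded set where
  \<open>f\<close> stays away from \<open>q\<close>, and there every nearby function is still below \<open>q\<close>.
\<close>

lemma eventually_quantile_le:
  assumes q: "quantile D p f < q"
  shows "\<forall>\<^sub>F g in at f. quantile D p g \<le> q"
proof -
  have "p * measure \<mu> D < measure \<mu> (D \<inter> {x. ev f x < q})"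
    by (rule strictly_above_quantile[OF q])
  then have "\<exists>k::nat. p * measure \<mu> D < measure \<mu> (D \<inter> {x. ev f x \<le> q - 1 / Suc k} \<inter> cball 0 (Suc k))"
  proof (rule exhaustion[rotated 4])
    show "incseq (\<lambda>k. D \<inter> {x. ev f x \<le> q - 1 / real (Suc k)} \<inter> cball 0 (Suc k))"
    proof (rule incseq_SucI, safe)
      fix k x assume "ev f x \<le> q - 1 / real (Suc k)"
      then show "ev f x \<le> q - 1 / real (Suc (Suc k))"
        using inverse_Suc_antimono[of k] by linarith
    qed auto
    show "D \<inter> {x. ev f x < q} \<subseteq> (\<Union>k. D \<inter> {x. ev f x \<le> q - 1 / real (Suc k)} \<inter> cball 0 (Suc k))"
    proof
      fix x assume x: "x \<in> D \<inter> {x. ev f x < q}"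
      then obtain k where k: "1 / real (Suc k) < q - ev f x"
        using reals_Archimedean[of "q - ev f x"] by (auto simp: inverse_eq_divide)
      obtain l where l: "norm x \<le> real l" using real_arch_simple by blast
      have "1 / real (Suc (k + l)) \<le> 1 / real (Suc k)" by (intro divide_left_mono) auto
      then have "1 / real (Suc (k + l)) < q - ev f x" "norm x \<le> real (Suc (k + l))"
        using k l by auto
      with x show "x \<in> (\<Union>k. D \<inter> {x. ev f x \<le> q - 1 / real (Suc k)} \<inter> cball 0 (Suc k))"
        by (auto intro!: exI[of _ "k + l"])
    qed
    show "D \<inter> {x. ev f x \<le> q - 1 / real (Suc k)} \<inter> cball 0 (Suc k) \<in> sets \<mu>" for k
      using D(1) by (intro measurable_closed closed_Int) auto
  qed (use D in auto)
  then obtain k :: nat where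
    k: "p * measure \<mu> D < measure \<mu> (D \<inter> {x. ev f x \<le> q - 1 / Suc k} \<inter> cball 0 (Suc k))" ..
  \<comment> \<open>On the ball of radius \<open>Suc k\<close> this keeps the change of values within the gap \<open>1 / Suc k\<close>.\<close>
  define \<delta> where "\<delta> = 1 / (2 * real (Suc k) * real (Suc k))"
  have "\<delta> > 0" by (simp add: \<delta>_def)
  have "quantile D p g \<le> q" if "dist g f < \<delta>" for g
  proof -
    have "D \<inter> {x. ev f x \<le> q - 1 / Suc k} \<inter> cball 0 (Suc k) \<subseteq> D \<inter> {x. ev g x \<le> q}"
    proof
      fix x assume x: "x \<in> D \<inter> {x. ev f x \<le> q - 1 / Suc k} \<inter> cball 0 (Suc k)"
      have "\<bar>ev g x - ev f x\<bar> \<le> 2 * real (Suc k) * dist g f"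
        using x by (intro abs_ev_diff_le) auto
      also have "\<dots> \<le> 2 * real (Suc k) * \<delta>" using that by (intro mult_left_mono) auto
      also have "\<dots> = 1 / Suc k" unfolding \<delta>_def by (simp del: of_nat_Suc)
      finally show "x \<in> D \<inter> {x. ev g x \<le> q}" using x by auto
    qed
    then have "measure \<mu> (D \<inter> {x. ev f x \<le> q - 1 / Suc k} \<inter> cball 0 (Suc k)) \<le> measure \<mu> (D \<inter> {x. ev g x \<le> q})"
      using D by (intro finite_measure_mono) auto
    with k have "reaches D p g q" by (simp add: reaches_def)
    then show ?thesis by (simp add: quantile_le_iff)
  qed
  with \<open>\<delta> > 0\<close> show ?thesis by (auto simp: eventually_at)
qed

text \<open>
  Almost all of \<open>D\<close> is interior, where \<open>Y\<close> is positive; so the sets on which \<open>k\<close> times \<open>Y\<close> outweighs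
  \<open>f - M\<close> exhaust almost all of the mass.
\<close>

lemma quantile_drop:
  assumes Y: "\<And>x. x \<in> D \<Longrightarrow> 0 \<le> ev Y x" "\<And>x. x \<in> interior D \<Longrightarrow> 0 < ev Y x"
  shows "\<exists>a0. \<forall>a\<ge>a0. quantile D p (f - a *\<^sub>R Y) \<le> M"
proof -
  have "negligible (D - interior D)"
    using negligible_convex_frontier[OF D(2)] D(1) by (simp add: frontier_def)
  then have "measure \<mu> (D - interior D) = 0"
    using D by (subst measure_eq_0_iff) auto
  moreover have "measure \<mu> (D - interior D) = measure \<mu> D - measure \<mu> (interior D)"
    using D interior_subset[of D] by (intro finite_measure_Diff) auto
  ultimately have "measure \<mu> (interior D) = measure \<mu> D" by linarith
  moreover have "p * measure \<mu> D < 1 * measure \<mu> D" using p D by (intro mult_strict_right_mono) auto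
  ultimately have "p * measure \<mu> D < measure \<mu> (interior D)" by simp
  then have "\<exists>k::nat. p * measure \<mu> D < measure \<mu> (D \<inter> {x. ev f x - M \<le> real k * ev Y x})"
  proof (rule exhaustion[rotated 4])
    show "incseq (\<lambda>k. D \<inter> {x. ev f x - M \<le> real k * ev Y x})"
    proof (rule incseq_SucI, safe)
      fix k x assume "x \<in> D" "ev f x - M \<le> real k * ev Y x"
      then show "ev f x - M \<le> real (Suc k) * ev Y x"
        using Y(1)[of x] by (simp add: algebra_simps)
    qed
    show "interior D \<subseteq> (\<Union>k. D \<inter> {x. ev f x - M \<le> real k * ev Y x})"
    proof
      fix x assume x: "x \<in> interior D"
      obtain k where "(ev f x - M) / ev Y x \<le> real k" using real_arch_simple by blast
      then have "ev f x - M \<le> real k * ev Y x" using Y(2)[OF x] by (simp add: field_simps)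
      with x interior_subset[of D] show "x \<in> (\<Union>k. D \<inter> {x. ev f x - M \<le> real k * ev Y x})"
        by (auto intro!: exI[of _ k])
    qed
    show "D \<inter> {x. ev f x - M \<le> real k * ev Y x} \<in> sets \<mu>" for k
      using D(1) by (intro measurable_closed closed_Int closed_Collect_le continuous_intros)
  qed auto
  then obtain k :: nat where k: "p * measure \<mu> D < measure \<mu> (D \<inter> {x. ev f x - M \<le> real k * ev Y x})" ..
  have "quantile D p (f - a *\<^sub>R Y) \<le> M" if "a \<ge> real k" for a
  proof -
    have "D \<inter> {x. ev f x - M \<le> real k * ev Y x} \<subseteq> D \<inter> {x. ev (f - a *\<^sub>R Y) x \<le> M}"
    proof safe
      fix x assume x: "x \<in> D" "ev f x - M \<le> real k * ev Y x"
      have "real k * ev Y x \<le> a * ev Y x" using that Y(1)[OF x(1)] by (intro mult_right_mono) auto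
      with x show "ev (f - a *\<^sub>R Y) x \<le> M" by simp
    qed
    then have "measure \<mu> (D \<inter> {x. ev f x - M \<le> real k * ev Y x}) \<le> measure \<mu> (D \<inter> {x. ev (f - a *\<^sub>R Y) x \<le> M})"
      using D(1) by (intro finite_measure_mono) (auto simp del: ev_simps)
    with k show ?thesis by (simp add: quantile_le_iff reaches_def)
  qed
  then show ?thesis by blast
qed

end

context full_support_measure
begin

lemma quantile_like_quantile:
  assumes D: "closed D" "convex D" "0 < measure \<mu> D" and p: "0 < p" "p < 1"
  shows "quantile_like D (quantile D p)"
proof -
  interpret P: body \<mu> D p using D p by unfold_locales auto
  interpret N: body \<mu> D "1 - p" using D p by unfold_locales auto
  have neg: "quantile D p f = - quantile D (1 - p) (- f)" for f
    using P.quantile_uminus[of f] by simp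
  show ?thesis
    unfolding quantile_like_def
  proof (intro conjI allI impI)
    fix f :: "'a \<times> real" and c
    have "reaches D p (f + (0, c)) q \<longleftrightarrow> reaches D p f (q - c)" for q
      by (simp add: reaches_def algebra_simps)
    then have "quantile D p (f + (0, c)) \<le> q \<longleftrightarrow> quantile D p f + c \<le> q" for q
      by (simp add: P.quantile_le_iff[symmetric] algebra_simps)
    then show "quantile D p (f + (0, c)) = quantile D p f + c"
      by (meson order_antisym order_refl)
  next
    fix f g :: "'a \<times> real"
    assume le: "\<forall>x\<in>D. ev f x \<le> ev g x"
    have "reaches D p g (quantile D p g)" using P.quantile_le_iff by blast
    moreover have "measure \<mu> (D \<inter> {x. ev g x \<le> q}) \<le> measure \<mu> (D \<inter> {x. ev f x \<le> q})" for q
      using D le by (intro finite_measure_mono) (auto intro: order_trans)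
    ultimately have "reaches D p f (quantile D p g)"
      unfolding reaches_def by (meson order_trans)
    then show "quantile D p f \<le> quantile D p g" by (simp add: P.quantile_le_iff)
  next
    show "continuous_on UNIV (quantile D p)"
      unfolding continuous_on_def
    proof (rule ballI, rule order_tendstoI)
      fix f :: "'a \<times> real" and q
      assume "quantile D p f < q"
      then obtain r where r: "quantile D p f < r" "r < q" using dense by blast
      from P.eventually_quantile_le[OF r(1)] show "\<forall>\<^sub>F g in at f. quantile D p g < q"
        by eventually_elim (use r in auto)
    next
      fix f :: "'a \<times> real" and q
      assume "q < quantile D p f"
      then obtain r where r: "q < r" "r < quantile D p f" using dense by blast
      then have "quantile D (1 - p) (- f) < - r" using neg[of f] by simp
      from N.eventually_quantile_le[OF this] have "\<forall>\<^sub>F g in at (- f). quantile D (1 - p) g \<le> - r" .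
      then obtain d where "d > 0"
        and d: "\<And>g. g \<noteq> - f \<Longrightarrow> dist g (- f) < d \<Longrightarrow> quantile D (1 - p) g \<le> - r"
        unfolding eventually_at by blast
      have "quantile D (1 - p) (- g) \<le> - r" if "g \<noteq> f" "dist g f < d" for g
        using that by (intro d) (simp_all add: dist_norm norm_minus_commute)
      with \<open>d > 0\<close> have "\<forall>\<^sub>F g in at f. quantile D (1 - p) (- g) \<le> - r"
        unfolding eventually_at by blast
      then show "\<forall>\<^sub>F g in at f. q < quantile D p g"
      proof eventually_elim
        case (elim g)
        with r(1) neg[of g] show ?case by linarith
      qed
    qed
  next
    fix f Y :: "'a \<times> real" and M
    assume Y: "\<forall>x\<in>D. 0 \<le> ev Y x" "\<forall>x\<in>interior D. 0 < ev Y x"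
    obtain a1 where a1: "\<And>a. a \<ge> a1 \<Longrightarrow> quantile D p (f - a *\<^sub>R Y) \<le> M"
      using P.quantile_drop[of Y f M] Y by blast
    obtain a2 where a2: "\<And>a. a \<ge> a2 \<Longrightarrow> quantile D (1 - p) (- f - a *\<^sub>R Y) \<le> - M"
      using N.quantile_drop[of Y "- f" "- M"] Y by blast
    have "M \<le> quantile D p (f + a *\<^sub>R Y)" if "a \<ge> a2" for a
      using a2[OF that] neg[of "f + a *\<^sub>R Y"] by simp
    with a1 show "\<exists>a0. \<forall>a\<ge>a0. quantile D p (f - a *\<^sub>R Y) \<le> M \<and> M \<le> quantile D p (f + a *\<^sub>R Y)"
      by (intro exI[of _ "max a1 a2"]) auto
  qed
qed

text \<open>
  In general the closed tails at a quantile have at least the masses \<open>p\<close> and \<open>1 - p\<close>.  They have exactly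
  these masses for nonconstant \<open>f\<close>, because the level set is then a null set.
\<close>

lemma quantile_eq_0:
  assumes D: "closed D" "convex D" "0 < measure \<mu> D" and p: "0 < p" "p < 1"
    and f: "fst f \<noteq> 0" "quantile D p f = 0"
  shows "measure \<mu> (D \<inter> {x. ev f x \<le> 0}) = p * measure \<mu> D"
    and "measure \<mu> (D \<inter> {x. 0 \<le> ev f x}) = (1 - p) * measure \<mu> D"
proof -
  interpret P: body \<mu> D p using D p by unfold_locales auto
  interpret N: body \<mu> D "1 - p" using D p by unfold_locales auto
  have "p * measure \<mu> D \<le> measure \<mu> (D \<inter> {x. ev f x \<le> 0})"
    using P.quantile_le_iff[of f 0] f by (simp add: reaches_def)
  moreover have "(1 - p) * measure \<mu> D \<le> measure \<mu> (D \<inter> {x. 0 \<le> ev f x})"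
    using N.quantile_le_iff[of "- f" 0] P.quantile_uminus[of f] f p by (simp add: reaches_def)
  moreover have "measure \<mu> D = measure \<mu> (D \<inter> {x. ev f x \<le> 0}) + measure \<mu> (D \<inter> {x. 0 \<le> ev f x})"
    by (rule measure_split_closed[OF D(1) f(1)])
  ultimately show "measure \<mu> (D \<inter> {x. ev f x \<le> 0}) = p * measure \<mu> D"
    "measure \<mu> (D \<inter> {x. 0 \<le> ev f x}) = (1 - p) * measure \<mu> D"
    by (auto simp: algebra_simps)
qed

end

section \<open>Yao-Yao systems of cells and graphs\<close>

text \<open>
  Cells are addressed by the side that they take at each cut, the most recent cut first.
\<close>

definition cells :: "'a set \<Rightarrow> bool list set" where
  "cells B = {j. length j = card B}"

text \<open>
  A family of cells \<open>C\<close> and a linear space \<open>\<G>\<close> of piecewise affine graphs over them, in the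
  coordinates \<open>B\<close>.  The assumptions \<open>one_sided\<close> and \<open>solve\<close> pull in opposite directions: enlarging
  \<open>\<G>\<close> helps the latter and hurts the former.  In \<open>solve\<close> the functionals may be chosen separately on
  each cell, so that one graph meets one condition per cell.
\<close>

locale yao_yao =
  fixes B :: "'a::euclidean_space set" and C :: "bool list \<Rightarrow> 'a set"
    and \<G> :: "(bool list \<Rightarrow> 'a \<times> real) set"
  assumes closed_cell: "j \<in> cells B \<Longrightarrow> closed (C j)"
    and convex_cell: "j \<in> cells B \<Longrightarrow> convex (C j)"
    and cover: "\<exists>j\<in>cells B. x \<in> C j"
    and overlap: "i \<in> cells B \<Longrightarrow> j \<in> cells B \<Longrightarrow> i \<noteq> j \<Longrightarrow> negligible (C i \<inter> C j)"
    and zero_graph: "(\<lambda>_. 0) \<in> \<G>"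
    and diff_scale_graph: "F \<in> \<G> \<Longrightarrow> G \<in> \<G> \<Longrightarrow> (\<lambda>j. F j - \<beta> *\<^sub>R G j) \<in> \<G>"
    and graph_in_span: "G \<in> \<G> \<Longrightarrow> j \<in> cells B \<Longrightarrow> fst (G j) \<in> span B"
    and one_sided: "fst m \<in> span B \<Longrightarrow> G \<in> \<G> \<Longrightarrow>
        \<exists>j\<in>cells B. (\<forall>x\<in>C j. ev (G j) x \<le> ev m x) \<or> (\<forall>x\<in>C j. ev m x \<le> ev (G j) x)"
    and solve: "(\<And>j. j \<in> cells B \<Longrightarrow> quantile_like (C j) (\<Phi> j)) \<Longrightarrow>
        \<exists>F\<in>\<G>. \<forall>j\<in>cells B. \<Phi> j (f - F j) = 0"

lemma Basis_minus_span_nonzero: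
  assumes "B \<subseteq> Basis" "b \<in> Basis" "b \<notin> B" "v \<in> span B"
  shows "b - v \<noteq> 0"
proof -
  have "v \<bullet> b = 0"
    using assms(4)
  proof (induction rule: span_induct_alt)
    case (step c x y)
    then have "x \<bullet> b = 0" using assms by (intro inner_not_same_Basis) auto
    with step show ?case by (simp add: inner_add_left)
  qed auto
  then have "(b - v) \<bullet> b = 1" using assms by (simp add: inner_diff_left)
  then show ?thesis by auto
qed

lemma cells_empty: "cells {} = {[]}"
  by (auto simp: cells_def)

lemma cells_insert:
  assumes "finite B" "b \<notin> B"
  shows "cells (insert b B) = {s # j |s j. j \<in> cells B}"
  using assms by (auto simp: cells_def length_Suc_conv)

text \<open>
  With no coordinates there is one cell, and graphs are constants: two constants are always comparable,
  and translation equivariance of the functional solves the equation.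
\<close>

lemma yao_yao_empty: "yao_yao {} (\<lambda>_. UNIV) {G. \<exists>c. \<forall>j. G j = (0, c)}"
proof (unfold_locales, unfold cells_empty)
  fix f :: "'a \<times> real" and \<Phi> :: "bool list \<Rightarrow> 'a \<times> real \<Rightarrow> real"
  assume "\<And>j. j \<in> {[]} \<Longrightarrow> quantile_like UNIV (\<Phi> j)"
  then have "\<Phi> [] (f + (0, - \<Phi> [] f)) = 0"
    using quantile_likeD(1)[of UNIV "\<Phi> []"] by simp
  moreover have "f + (0, - \<Phi> [] f) = f - (0, \<Phi> [] f)" by (simp add: prod_eq_iff)
  ultimately show "\<exists>F\<in>{G. \<exists>c. \<forall>j. G j = (0, c)}. \<forall>j\<in>{[]}. \<Phi> j (f - F j) = 0"
    by (intro bexI[of _ "\<lambda>_. (0, \<Phi> [] f)"]) auto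
next
  fix m :: "'a \<times> real" and G
  assume "fst m \<in> span {}" "G \<in> {G :: bool list \<Rightarrow> 'a \<times> real. \<exists>c. \<forall>j. G j = (0, c)}"
  then obtain c where "fst m = 0" "G [] = (0, c)" by auto
  then show "\<exists>j\<in>{[]}. (\<forall>x\<in>UNIV. ev (G j) x \<le> ev m x) \<or> (\<forall>x\<in>UNIV. ev m x \<le> ev (G j) x)"
    by (auto simp: ev_def)
qed (auto simp: zero_prod_def)

abbreviation side_sign :: "bool \<Rightarrow> real" where "side_sign s \<equiv> (if s then 1 else - 1)"

text \<open>
  Each cell is cut along the zero set of its function \<open>Y j\<close>, which below is the new coordinate minus a
  graph over the old ones.
\<close>

definition split_cells :: "(bool list \<Rightarrow> 'a set) \<Rightarrow> (bool list \<Rightarrow> 'a::euclidean_space \<times> real) \<Rightarrow> bool list \<Rightarrow> 'a set" where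
  "split_cells C Y l = C (tl l) \<inter> {x. 0 \<le> side_sign (hd l) * ev (Y (tl l)) x}"

text \<open>
  A graph over the refined cells may have any new slope \<open>a j\<close> across the wall of the old cell \<open>j\<close>, but
  the two children of \<open>j\<close> must share it.  There is one new parameter per old cell, so the number of
  parameters doubles along with the number of cells.
\<close>

definition split_graphs ::
  "'a set \<Rightarrow> (bool list \<Rightarrow> 'a::euclidean_space \<times> real) set \<Rightarrow> (bool list \<Rightarrow> 'a \<times> real) \<Rightarrow> (bool list \<Rightarrow> 'a \<times> real) set" where
  "split_graphs B \<G> Y = {G'. \<exists>F\<in>\<G>. \<exists>a. \<forall>j\<in>cells B. \<forall>s. G' (s # j) = F j + a j *\<^sub>R Y j}"

lemma split_cells_simps [simp]:
  "split_cells C Y (True # j) = C j \<inter> {x. 0 \<le> ev (Y j) x}"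
  "split_cells C Y (False # j) = C j \<inter> {x. ev (Y j) x \<le> 0}"
  by (simp_all add: split_cells_def)

text \<open>
  One-sidedness persists because \<open>m\<close> minus a new graph is, on cell \<open>j\<close>, the difference for the old
  system (with \<open>F - \<beta> *\<^sub>R G\<close> in place of the graph, where \<open>\<beta>\<close> is the slope of \<open>m\<close> in direction \<open>b\<close>)
  plus \<open>(\<beta> - a j) * Y j\<close>: where the old difference has a sign, choose the child on which \<open>Y j\<close> makes the
  second summand agree with it.  Solvability persists by merging the functionals of two siblings:
  the old system then supplies \<open>F\<close>, and the crossing slopes supply \<open>a\<close>.
\<close>

lemma yao_yao_insert:
  fixes B :: "'a::euclidean_space set"
  assumes yy: "yao_yao B C \<G>" and B: "B \<subseteq> Basis" and b: "b \<in> Basis" "b \<notin> B"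
    and G: "G \<in> \<G>" and Y: "Y = (\<lambda>j. (b, 0) - G j)"
  shows "yao_yao (insert b B) (split_cells C Y) (split_graphs B \<G> Y)"
proof -
  have "finite B" using B finite_Basis finite_subset by blast
  note ci = cells_insert[OF this b(2)]
  interpret yao_yao B C \<G> by (rule yy)
  have Y0: "fst (Y j) \<noteq> 0" if "j \<in> cells B" for j
    using Basis_minus_span_nonzero[OF B b graph_in_span[OF G that]] by (simp add: Y)
  have sp: "span B \<subseteq> span (insert b B)" by (intro span_mono) auto
  show ?thesis
  proof
    fix l assume "l \<in> cells (insert b B)"
    then obtain s j where l: "l = s # j" "j \<in> cells B" unfolding ci by auto
    then show "closed (split_cells C Y l)" "convex (split_cells C Y l)"
      using closed_cell convex_cell by (cases s; force intro: closed_Int convex_Int)+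
  next
    fix x
    obtain j where j: "j \<in> cells B" "x \<in> C j" using cover by blast
    then have "x \<in> split_cells C Y ((0 \<le> ev (Y j) x) # j)" by (simp add: split_cells_def)
    with j show "\<exists>l\<in>cells (insert b B). x \<in> split_cells C Y l" unfolding ci by blast
  next
    fix l l' assume "l \<in> cells (insert b B)" "l' \<in> cells (insert b B)" and ne: "l \<noteq> l'"
    then obtain s j s' j' where l: "l = s # j" "j \<in> cells B" "l' = s' # j'" "j' \<in> cells B"
      unfolding ci by auto
    show "negligible (split_cells C Y l \<inter> split_cells C Y l')"
    proof (cases "j = j'")
      case False
      then have "negligible (C j \<inter> C j')" using overlap l by blast
      then show ?thesis by (rule negligible_subset) (auto simp: split_cells_def l)
    next
      case True
      then have "s \<noteq> s'" using ne l by auto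
      then show ?thesis
        using True l by (intro negligible_subset[OF negligible_ev_eq[OF Y0[OF l(2)], of 0]])
          (auto simp: split_cells_def split: if_splits)
    qed
  next
    show "(\<lambda>_. 0) \<in> split_graphs B \<G> Y"
      using zero_graph by (auto simp: split_graphs_def intro!: bexI[of _ "\<lambda>_. 0"] exI[of _ "\<lambda>_. 0"])
  next
    fix F' G' \<beta> assume "F' \<in> split_graphs B \<G> Y" "G' \<in> split_graphs B \<G> Y"
    then obtain F1 a1 F2 a2 where
      F: "F1 \<in> \<G>" "\<And>j s. j \<in> cells B \<Longrightarrow> F' (s # j) = F1 j + a1 j *\<^sub>R Y j"
        "F2 \<in> \<G>" "\<And>j s. j \<in> cells B \<Longrightarrow> G' (s # j) = F2 j + a2 j *\<^sub>R Y j"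
      unfolding split_graphs_def by blast
    have "(\<lambda>j. F1 j - \<beta> *\<^sub>R F2 j) \<in> \<G>" using diff_scale_graph F by blast
    moreover have "\<forall>j\<in>cells B. \<forall>s. F' (s # j) - \<beta> *\<^sub>R G' (s # j) =
        (F1 j - \<beta> *\<^sub>R F2 j) + (a1 j - \<beta> * a2 j) *\<^sub>R Y j"
      using F by (simp add: algebra_simps)
    ultimately show "(\<lambda>j. F' j - \<beta> *\<^sub>R G' j) \<in> split_graphs B \<G> Y"
      unfolding split_graphs_def
      by (auto intro!: bexI[of _ "\<lambda>j. F1 j - \<beta> *\<^sub>R F2 j"] exI[of _ "\<lambda>j. a1 j - \<beta> * a2 j"])
  next
    fix G' l assume "G' \<in> split_graphs B \<G> Y" "l \<in> cells (insert b B)"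
    then obtain s j F a where l: "l = s # j" "j \<in> cells B" "F \<in> \<G>" "G' l = F j + a j *\<^sub>R Y j"
      unfolding split_graphs_def ci by blast
    have "fst (F j) \<in> span (insert b B)" "fst (G j) \<in> span (insert b B)"
      using graph_in_span l G sp by blast+
    then show "fst (G' l) \<in> span (insert b B)"
      unfolding l(4) Y fst_add fst_scaleR fst_diff fst_conv
      by (intro span_add span_scale span_diff) (auto intro: span_base)
  next
    fix m :: "'a \<times> real" and G' assume m: "fst m \<in> span (insert b B)" and G': "G' \<in> split_graphs B \<G> Y"
    then obtain F a where F: "F \<in> \<G>" "\<And>j s. j \<in> cells B \<Longrightarrow> G' (s # j) = F j + a j *\<^sub>R Y j"
      unfolding split_graphs_def by blast
    obtain \<beta> where \<beta>: "fst m - \<beta> *\<^sub>R b \<in> span B"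
      using m by (auto simp: span_breakdown_eq)
    \<comment> \<open>Remove the dependence of \<open>m\<close> on the new coordinate, to compare it with an old graph.\<close>
    define m' where "m' = m - (\<beta> *\<^sub>R b, 0)"
    have "fst m' \<in> span B" using \<beta> by (simp add: m'_def)
    then obtain j where j: "j \<in> cells B" and
      "(\<forall>x\<in>C j. ev (F j - \<beta> *\<^sub>R G j) x \<le> ev m' x) \<or> (\<forall>x\<in>C j. ev m' x \<le> ev (F j - \<beta> *\<^sub>R G j) x)"
      using one_sided[OF _ diff_scale_graph[OF F(1) G]] by blast
    moreover have "ev m x - ev (G' (s # j)) x =
        (ev m' x - ev (F j - \<beta> *\<^sub>R G j) x) + (\<beta> - a j) * ev (Y j) x" for s x
      unfolding F(2)[OF j] m'_def Y by (simp add: ev_def algebra_simps)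
    ultimately consider
        (ge) "\<And>x s. x \<in> C j \<Longrightarrow> (\<beta> - a j) * ev (Y j) x \<le> ev m x - ev (G' (s # j)) x"
      | (le) "\<And>x s. x \<in> C j \<Longrightarrow> ev m x - ev (G' (s # j)) x \<le> (\<beta> - a j) * ev (Y j) x"
      by fastforce
    then have "\<exists>s. (\<forall>x\<in>split_cells C Y (s # j). ev (G' (s # j)) x \<le> ev m x) \<or>
        (\<forall>x\<in>split_cells C Y (s # j). ev m x \<le> ev (G' (s # j)) x)"
    proof cases
      case ge
      have "ev (G' ((a j \<le> \<beta>) # j)) x \<le> ev m x" if "x \<in> split_cells C Y ((a j \<le> \<beta>) # j)" for x
      proof -
        have "0 \<le> (\<beta> - a j) * ev (Y j) x"
          using that by (auto simp: split_cells_def split: if_splits intro: mult_nonneg_nonneg mult_nonpos_nonpos)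
        moreover have "x \<in> C j" using that by (simp add: split_cells_def)
        ultimately show ?thesis using ge[of x "a j \<le> \<beta>"] by linarith
      qed
      then show ?thesis by blast
    next
      case le
      have "ev m x \<le> ev (G' ((\<beta> \<le> a j) # j)) x" if "x \<in> split_cells C Y ((\<beta> \<le> a j) # j)" for x
      proof -
        have "(\<beta> - a j) * ev (Y j) x \<le> 0"
          using that by (auto simp: split_cells_def split: if_splits intro: mult_nonneg_nonpos mult_nonpos_nonneg)
        moreover have "x \<in> C j" using that by (simp add: split_cells_def)
        ultimately show ?thesis using le[of x "\<beta> \<le> a j"] by linarith
      qed
      then show ?thesis by blast
    qed
    with j show "\<exists>l\<in>cells (insert b B). (\<forall>x\<in>split_cells C Y l. ev (G' l) x \<le> ev m x) \<or>
        (\<forall>x\<in>split_cells C Y l. ev m x \<le> ev (G' l) x)"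
      unfolding ci by blast
  next
    fix f :: "'a \<times> real" and \<Phi> :: "bool list \<Rightarrow> 'a \<times> real \<Rightarrow> real"
    assume \<Phi>: "\<And>l. l \<in> cells (insert b B) \<Longrightarrow> quantile_like (split_cells C Y l) (\<Phi> l)"
    have "\<exists>\<Psi>. quantile_like (C j) \<Psi> \<and>
        (\<forall>f. \<exists>a. \<forall>s. \<Phi> (s # j) (f - a *\<^sub>R Y j) = \<Psi> f)" if j: "j \<in> cells B" for j
    proof -
      have "quantile_like (C j \<inter> {x. 0 \<le> ev (Y j) x}) (\<Phi> (True # j))"
        "quantile_like (C j \<inter> {x. ev (Y j) x \<le> 0}) (\<Phi> (False # j))"
        using \<Phi> j unfolding ci split_cells_simps[symmetric] by blast+
      then obtain \<Psi> where \<Psi>: "quantile_like (C j) \<Psi>"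
        "\<And>f. \<exists>a. \<Phi> (True # j) (f - a *\<^sub>R Y j) = \<Psi> f \<and> \<Phi> (False # j) (f - a *\<^sub>R Y j) = \<Psi> f"
        using quantile_like_combine[OF _ _ Y0[OF j]] by metis
      show ?thesis
      proof (intro exI[of _ \<Psi>] conjI allI)
        fix f
        obtain a where "\<Phi> (True # j) (f - a *\<^sub>R Y j) = \<Psi> f \<and> \<Phi> (False # j) (f - a *\<^sub>R Y j) = \<Psi> f"
          using \<Psi>(2) by blast
        then have "\<Phi> (s # j) (f - a *\<^sub>R Y j) = \<Psi> f" for s by (cases s) auto
        then show "\<exists>a. \<forall>s. \<Phi> (s # j) (f - a *\<^sub>R Y j) = \<Psi> f" by blast
      qed (rule \<Psi>)
    qed
    then obtain \<Psi> where \<Psi>: "\<And>j. j \<in> cells B \<Longrightarrow> quantile_like (C j) (\<Psi> j)"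
      "\<And>j f. j \<in> cells B \<Longrightarrow> \<exists>a. \<forall>s. \<Phi> (s # j) (f - a *\<^sub>R Y j) = \<Psi> j f"
      by metis
    obtain F where F: "F \<in> \<G>" "\<And>j. j \<in> cells B \<Longrightarrow> \<Psi> j (f - F j) = 0"
      using solve[of \<Psi> f] \<Psi>(1) by blast
    have "\<exists>a. \<forall>s. \<Phi> (s # j) (f - F j - a *\<^sub>R Y j) = 0" if "j \<in> cells B" for j
      using \<Psi>(2)[OF that, of "f - F j"] F(2)[OF that] by simp
    then obtain a where a: "\<And>j s. j \<in> cells B \<Longrightarrow> \<Phi> (s # j) (f - F j - a j *\<^sub>R Y j) = 0"
      by metis
    define G' where "G' l = F (tl l) + a (tl l) *\<^sub>R Y (tl l)" for l
    have "G' \<in> split_graphs B \<G> Y" using F(1) by (auto simp: split_graphs_def G'_def)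
    moreover have "\<Phi> l (f - G' l) = 0" if "l \<in> cells (insert b B)" for l
      using that a unfolding ci by (auto simp: G'_def diff_diff_eq)
    ultimately show "\<exists>G'\<in>split_graphs B \<G> Y. \<forall>l\<in>cells (insert b B). \<Phi> l (f - G' l) = 0" by blast
  qed
qed

section \<open>Three parts per cell\<close>

context full_support_measure
begin

text \<open>
  Cutting every cell at its median when a coordinate is added halves all measures.
\<close>

lemma yao_yao_equipartition:
  assumes "B \<subseteq> Basis"
  shows "\<exists>C \<G>. yao_yao B C \<G> \<and> (\<forall>j\<in>cells B. measure \<mu> (C j) = measure \<mu> UNIV / 2 ^ card B)"
proof -
  have "finite B" using assms finite_Basis finite_subset by blast
  then show ?thesis
    using assms
  proof (induction B rule: finite_induct)
    case empty
    then show ?case using yao_yao_empty by (intro exI conjI) auto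
  next
    case (insert b B)
    then have b: "b \<in> Basis" "b \<notin> B" and B: "B \<subseteq> Basis" by auto
    obtain C \<G> where yy: "yao_yao B C \<G>"
      and mC: "\<And>j. j \<in> cells B \<Longrightarrow> measure \<mu> (C j) = measure \<mu> UNIV / 2 ^ card B"
      using insert by blast
    interpret yao_yao B C \<G> by (rule yy)
    have C: "closed (C j)" "convex (C j)" "0 < measure \<mu> (C j)" if "j \<in> cells B" for j
      using that closed_cell convex_cell mC[OF that] measure_open_pos[of UNIV] by auto
    then obtain G where G: "G \<in> \<G>" "\<And>j. j \<in> cells B \<Longrightarrow> quantile (C j) (1/2) ((b, 0) - G j) = 0"
      using solve[of "\<lambda>j. quantile (C j) (1/2)" "(b, 0)"] quantile_like_quantile[OF C] by auto
    define Y where "Y = (\<lambda>j. (b, 0) - G j)"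
    have "measure \<mu> (split_cells C Y l) = measure \<mu> UNIV / 2 ^ card (insert b B)"
      if l_cell: "l \<in> cells (insert b B)" for l
    proof -
      obtain s j where l: "l = s # j" "j \<in> cells B"
        using l_cell unfolding cells_insert[OF insert(1,2)] by blast
      have "fst (Y j) \<noteq> 0"
        using Basis_minus_span_nonzero[OF B b graph_in_span[OF G(1) l(2)]] by (simp add: Y_def)
      from quantile_eq_0[OF C[OF l(2)] _ _ this, of "1/2"] G(2)[OF l(2)]
      have "measure \<mu> (C j \<inter> {x. ev (Y j) x \<le> 0}) = 1/2 * measure \<mu> (C j)"
        "measure \<mu> (C j \<inter> {x. 0 \<le> ev (Y j) x}) = 1/2 * measure \<mu> (C j)"
        by (auto simp: Y_def simp del: ev_simps)
      then have "measure \<mu> (split_cells C Y l) = 1/2 * measure \<mu> (C j)"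
        by (cases s) (simp_all add: l)
      then show ?thesis using mC[OF l(2)] insert by simp
    qed
    with yao_yao_insert[OF yy B b G(1) Y_def] show ?case by blast
  qed
qed

text \<open>
  Overlaps of measure zero suffice: a convex set of positive measure has interior points, and a set with
  interior points is not negligible.
\<close>

lemma convex_partition_family:
  assumes "finite I" "(\<Union>i\<in>I. P i) = UNIV" "c > 0"
    and P: "\<And>i. i \<in> I \<Longrightarrow> closed (P i) \<and> convex (P i) \<and> measure \<mu> (P i) = c"
    and neg: "\<And>i j. i \<in> I \<Longrightarrow> j \<in> I \<Longrightarrow> i \<noteq> j \<Longrightarrow> negligible (P i \<inter> P j)"
  shows "inj_on P I" and "convex_partition (card I) (P ` I)"
proof -
  show inj: "inj_on P I"
  proof (rule inj_onI, rule ccontr)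
    fix i j assume ij: "i \<in> I" "j \<in> I" "P i = P j" "i \<noteq> j"
    then have "negligible (P i)" using neg[of i j] by simp
    then show False using P[OF ij(1)] measure_eq_0_iff[of "P i"] \<open>c > 0\<close> by auto
  qed
  have "interior (P i) \<inter> interior (P j) = {}" if "i \<in> I" "j \<in> I" "P i \<noteq> P j" for i j
  proof -
    have "negligible (interior (P i \<inter> P j))"
      using that neg[of i j] negligible_subset interior_subset by metis
    then show ?thesis
      using open_not_negligible[of "interior (P i \<inter> P j)"] by auto
  qed
  moreover have "interior (P i) \<noteq> {}" if "i \<in> I" for i
    using P[OF that] \<open>c > 0\<close> by (intro interior_nonempty_if_measure_pos) auto
  ultimately show "convex_partition (card I) (P ` I)"
    unfolding convex_partition_def using assms(1,2) P card_image[OF inj] by auto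
qed

end

lemma avoids_halfspace:
  assumes "fst f \<noteq> 0" "(\<forall>x\<in>S. 0 \<le> ev f x) \<or> (\<forall>x\<in>S. ev f x \<le> 0)"
  shows "avoids {x. ev f x = 0} S"
  using assms(2)
proof
  assume "\<forall>x\<in>S. 0 \<le> ev f x"
  then have "0 < ev f x" if "x \<in> interior S" for x
    using assms(1) that by (intro ev_pos_on_interior[of f S]) auto
  then show ?thesis by (fastforce simp: avoids_def)
next
  assume "\<forall>x\<in>S. ev f x \<le> 0"
  then have "0 < ev (- f) x" if "x \<in> interior S" for x
    using assms(1) that by (intro ev_pos_on_interior[of "- f" S]) auto
  then show ?thesis by (fastforce simp: avoids_def)
qed

lemma diff_coordinate_in_span:
  assumes "b \<in> Basis" shows "a - (a \<bullet> b) *\<^sub>R b \<in> span (Basis - {b})"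
proof -
  have "a = (a \<bullet> b) *\<^sub>R b + (\<Sum>i\<in>Basis - {b}. (a \<bullet> i) *\<^sub>R i)"
    using euclidean_representation[of a] sum.remove[OF finite_Basis assms, of "\<lambda>i. (a \<bullet> i) *\<^sub>R i"] by simp
  then have "a - (a \<bullet> b) *\<^sub>R b = (\<Sum>i\<in>Basis - {b}. (a \<bullet> i) *\<^sub>R i)"
    by (simp add: algebra_simps)
  also have "\<dots> \<in> span (Basis - {b})" by (intro span_sum span_scale span_base)
  finally show ?thesis .
qed

context full_support_measure
begin

text \<open>
  Every cell is cut first along \<open>G1\<close>, a third of it being below, and then its upper piece \<open>D j\<close> is
  bisected along \<open>G2\<close>.  The lower piece is left alone by \<open>G2\<close>, so crossings of the two graphs are harmless.
\<close>

lemma partition_avoided_twice: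
  "\<exists>P. convex_partition (3 * 2 ^ (DIM('a) - 1)) P \<and>
       (\<forall>C\<in>P. \<forall>D\<in>P. measure \<mu> C = measure \<mu> D) \<and>
       (\<forall>H. hyperplane H \<longrightarrow> card {C\<in>P. avoids H C} \<ge> 2)"
proof -
  obtain b :: 'a where b: "b \<in> Basis" using nonempty_Basis by blast
  define B where "B = Basis - {b}"
  have B: "B \<subseteq> Basis" "card B = DIM('a) - 1" "b \<notin> B" using b by (auto simp: B_def)
  define m0 where "m0 = measure \<mu> UNIV / 2 ^ card B"
  have "m0 > 0" using measure_open_pos[of UNIV] by (simp add: m0_def)
  obtain C \<G> where yy: "yao_yao B C \<G>" and mC: "\<And>j. j \<in> cells B \<Longrightarrow> measure \<mu> (C j) = m0"
    using yao_yao_equipartition[OF B(1)] unfolding m0_def by blast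
  interpret yao_yao B C \<G> by (rule yy)
  have C: "closed (C j)" "convex (C j)" "0 < measure \<mu> (C j)" if "j \<in> cells B" for j
    using that closed_cell convex_cell mC \<open>m0 > 0\<close> by auto
  define f0 :: "'a \<times> real" where "f0 = (b, 0)"
  have f0: "fst (f0 - G j) \<noteq> 0" if "G \<in> \<G>" "j \<in> cells B" for G j
    using Basis_minus_span_nonzero[OF B(1) b B(3) graph_in_span[OF that]] by (simp add: f0_def)
  obtain G1 where G1: "G1 \<in> \<G>" "\<And>j. j \<in> cells B \<Longrightarrow> quantile (C j) (1/3) (f0 - G1 j) = 0"
    using solve[of "\<lambda>j. quantile (C j) (1/3)" f0] quantile_like_quantile[OF C] by auto
  define D where "D j = C j \<inter> {x. 0 \<le> ev (f0 - G1 j) x}" for j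
  have m1: "measure \<mu> (C j \<inter> {x. ev (f0 - G1 j) x \<le> 0}) = m0 / 3" "measure \<mu> (D j) = 2 * m0 / 3"
    if "j \<in> cells B" for j
    using quantile_eq_0[OF C[OF that] _ _ f0[OF G1(1) that] G1(2)[OF that]] mC[OF that]
    by (simp_all add: D_def del: ev_simps)
  have D: "closed (D j)" "convex (D j)" "0 < measure \<mu> (D j)" if "j \<in> cells B" for j
    using C[OF that] m1(2)[OF that] \<open>m0 > 0\<close>
    by (auto simp: D_def simp del: ev_simps intro!: closed_Int convex_Int)
  have "quantile_like (C j) (quantile (D j) (1/2))" if "j \<in> cells B" for j
    using D[OF that] by (intro quantile_like_mono[OF quantile_like_quantile]) (auto simp: D_def)
  then obtain G2 where G2: "G2 \<in> \<G>" "\<And>j. j \<in> cells B \<Longrightarrow> quantile (D j) (1/2) (f0 - G2 j) = 0"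
    using solve[of "\<lambda>j. quantile (D j) (1/2)" f0] by blast
  have m2: "measure \<mu> (D j \<inter> {x. ev (f0 - G2 j) x \<le> 0}) = m0 / 3"
    "measure \<mu> (D j \<inter> {x. 0 \<le> ev (f0 - G2 j) x}) = m0 / 3" if "j \<in> cells B" for j
    using quantile_eq_0[OF D[OF that] _ _ f0[OF G2(1) that] G2(2)[OF that]] m1(2)[OF that]
    by (simp_all del: ev_simps)
  define part where "part = (\<lambda>(j, i::nat).
     if i = 0 then C j \<inter> {x. ev (f0 - G1 j) x \<le> 0}
     else if i = 1 then D j \<inter> {x. ev (f0 - G2 j) x \<le> 0}
     else D j \<inter> {x. 0 \<le> ev (f0 - G2 j) x})"
  define I where "I = cells B \<times> {0, 1, 2::nat}"
  have "finite (cells B)" "card (cells B) = 2 ^ card B"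
    using finite_lists_length_eq[of "UNIV :: bool set" "card B"]
      card_lists_length_eq[of "UNIV :: bool set" "card B"] by (simp_all add: cells_def)
  then have I: "finite I" "card I = 3 * 2 ^ (DIM('a) - 1)"
    using B by (simp_all add: I_def card_cartesian_product)
  have sub: "part (j, i) \<subseteq> C j" for j i by (auto simp: part_def D_def)
  have part_cover: "(\<Union>p\<in>I. part p) = UNIV"
  proof (intro equalityI subsetI UNIV_I)
    fix x :: 'a assume "x \<in> UNIV"
    then obtain j where j: "j \<in> cells B" "x \<in> C j" using cover by blast
    then have "x \<in> part (j, 0) \<union> part (j, 1) \<union> part (j, 2)"
      by (auto simp: part_def D_def)
    with j show "x \<in> (\<Union>p\<in>I. part p)" unfolding I_def by blast
  qed
  have parts: "closed (part p) \<and> convex (part p) \<and> measure \<mu> (part p) = m0 / 3" if "p \<in> I" for p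
    using that C D m1 m2
    by (auto simp: I_def part_def simp del: ev_simps intro!: closed_Int convex_Int)
  have part_overlap: "negligible (part p \<inter> part q)" if pq: "p \<in> I" "q \<in> I" "p \<noteq> q" for p q
  proof -
    obtain j i j' i' where ji: "p = (j, i)" "q = (j', i')" "j \<in> cells B" "j' \<in> cells B"
      "i \<in> {0, 1, 2}" "i' \<in> {0, 1, 2}" using pq by (auto simp: I_def)
    show ?thesis
    proof (cases "j = j'")
      case False
      then have "negligible (C j \<inter> C j')" using overlap ji by blast
      then show ?thesis by (rule negligible_subset) (use sub ji in blast)
    next
      case True
      have "negligible ({x. ev (f0 - G1 j) x = 0} \<union> {x. ev (f0 - G2 j) x = 0})"
        using f0 G1 G2 ji by (intro negligible_Un negligible_ev_eq) auto
      then show ?thesis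
      proof (rule negligible_subset)
        show "part p \<inter> part q \<subseteq> {x. ev (f0 - G1 j) x = 0} \<union> {x. ev (f0 - G2 j) x = 0}"
          using True ji pq(3) by (auto simp: part_def D_def simp del: ev_simps split: if_splits)
      qed
    qed
  qed
  have "m0 / 3 > 0" using \<open>m0 > 0\<close> by simp
  note fam = convex_partition_family[OF I(1) part_cover this parts part_overlap]
  have two: "\<exists>p\<in>I. \<exists>q\<in>I. p \<noteq> q \<and> avoids H (part p) \<and> avoids H (part q)" if hyp: "hyperplane H" for H
  proof -
    obtain a c where a: "a \<noteq> 0" "H = {x. a \<bullet> x = c}" using hyp by (auto simp: hyperplane_def)
    define M where "M = (a, - c)"
    have M: "H = {x. ev M x = 0}" "fst M = a" using a by (auto simp: M_def ev_def)
    show ?thesis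
    proof (cases "a \<bullet> b = 0")
      case True
      then have "fst M \<in> span B" using diff_coordinate_in_span[OF b, of a] M by (simp add: B_def)
      then obtain j where j: "j \<in> cells B" "(\<forall>x\<in>C j. 0 \<le> ev M x) \<or> (\<forall>x\<in>C j. ev M x \<le> 0)"
        using one_sided[OF _ zero_graph] by fastforce
      have "avoids H (part (j, i))" for i
        unfolding M(1) by (rule avoids_halfspace) (use j sub a M in blast)+
      with j show ?thesis
        by (intro bexI[of _ "(j, 0)"] bexI[of _ "(j, 1)"]) (auto simp: I_def)
    next
      case False
      \<comment> \<open>The hyperplane is the graph of \<open>m\<close>, a function of the coordinates in \<open>B\<close> alone.\<close>
      define \<beta> where "\<beta> = a \<bullet> b"
      define m where "m = f0 - (1 / \<beta>) *\<^sub>R M"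
      have "\<beta> \<noteq> 0" using False by (simp add: \<beta>_def)
      have "fst m = (- 1 / \<beta>) *\<^sub>R (a - \<beta> *\<^sub>R b)"
        using \<open>\<beta> \<noteq> 0\<close> M by (simp add: m_def f0_def algebra_simps)
      then have m: "fst m \<in> span B"
        using diff_coordinate_in_span[OF b, of a] by (simp only: span_scale B_def \<beta>_def)
      have H: "H = {x. ev (f0 - m) x = 0}" "fst (f0 - m) \<noteq> 0"
        using M a \<open>\<beta> \<noteq> 0\<close> by (auto simp: m_def)
      have av: "avoids H S" if "(\<forall>x\<in>S. ev m x \<le> ev f0 x) \<or> (\<forall>x\<in>S. ev f0 x \<le> ev m x)" for S
        unfolding H(1) by (rule avoids_halfspace[OF H(2)]) (use that in auto)
      obtain j1 where j1: "j1 \<in> cells B"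
        "(\<forall>x\<in>C j1. ev (G1 j1) x \<le> ev m x) \<or> (\<forall>x\<in>C j1. ev m x \<le> ev (G1 j1) x)"
        using one_sided[OF m G1(1)] by blast
      obtain j2 where j2: "j2 \<in> cells B"
        "(\<forall>x\<in>C j2. ev (G2 j2) x \<le> ev m x) \<or> (\<forall>x\<in>C j2. ev m x \<le> ev (G2 j2) x)"
        using one_sided[OF m G2(1)] by blast
      from j1(2) show ?thesis
      proof
        assume "\<forall>x\<in>C j1. ev m x \<le> ev (G1 j1) x"
        then have "avoids H (part (j1, 1))" "avoids H (part (j1, 2))"
          by (intro av disjI1; force simp: part_def D_def)+
        with j1 show ?thesis
          by (intro bexI[of _ "(j1, 1)"] bexI[of _ "(j1, 2)"]) (auto simp: I_def)
      next
        assume "\<forall>x\<in>C j1. ev (G1 j1) x \<le> ev m x"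
        then have 0: "avoids H (part (j1, 0))"
          by (intro av disjI2) (force simp: part_def)
        from j2(2) show ?thesis
        proof
          assume "\<forall>x\<in>C j2. ev (G2 j2) x \<le> ev m x"
          then have "avoids H (part (j2, 1))"
            by (intro av disjI2) (force simp: part_def D_def)
          with 0 j1 j2 show ?thesis
            by (intro bexI[of _ "(j1, 0)"] bexI[of _ "(j2, 1)"]) (auto simp: I_def)
        next
          assume "\<forall>x\<in>C j2. ev m x \<le> ev (G2 j2) x"
          then have "avoids H (part (j2, 2))"
            by (intro av disjI1) (force simp: part_def D_def)
          with 0 j1 j2 show ?thesis
            by (intro bexI[of _ "(j1, 0)"] bexI[of _ "(j2, 2)"]) (auto simp: I_def)
        qed
      qed
    qed
  qed
  have "2 \<le> card {S \<in> part ` I. avoids H S}" if "hyperplane H" for H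
  proof -
    obtain p q where pq: "p \<in> I" "q \<in> I" "p \<noteq> q" "avoids H (part p)" "avoids H (part q)"
      using two[OF \<open>hyperplane H\<close>] by blast
    have "card {part p, part q} \<le> card {S \<in> part ` I. avoids H S}"
      using pq I(1) by (intro card_mono) auto
    moreover have "part p \<noteq> part q" using fam(1) pq by (auto dest: inj_onD)
    ultimately show ?thesis by simp
  qed
  moreover have "measure \<mu> S = measure \<mu> T" if ST: "S \<in> part ` I" "T \<in> part ` I" for S T
  proof -
    obtain p q where "p \<in> I" "q \<in> I" "S = part p" "T = part q" using ST by blast
    then show ?thesis by (simp only: parts)
  qed
  ultimately show ?thesis
    using fam(2) unfolding I(2) by (intro exI[of _ "part ` I"] conjI ballI allI impI)
qed

end

lemma nice_measure_full_support:
  assumes "nice_measure \<mu>"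
  shows "full_support_measure \<mu>"
proof -
  obtain f where fin: "finite_measure \<mu>" and sets: "sets \<mu> = sets borel"
    and f: "continuous_on UNIV f" "\<And>x. f x > 0" "\<mu> = density lborel (\<lambda>x. ennreal (f x))"
    using assms by (auto simp: nice_measure_def)
  interpret finite_measure \<mu> by (rule fin)
  have [measurable]: "f \<in> borel_measurable borel" using f(1) by (rule borel_measurable_continuous_onI)
  have "measure \<mu> A = 0 \<longleftrightarrow> negligible A" if A: "A \<in> sets borel" for A
  proof -
    have "measure \<mu> A = 0 \<longleftrightarrow> A \<in> null_sets \<mu>"
      using A sets by (auto simp: null_sets_def emeasure_eq_measure)
    also have "\<dots> \<longleftrightarrow> (AE x in lborel. x \<notin> A)"
    proof -
      have "ennreal (f x) \<noteq> 0" for x using f(2)[of x] by simp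
      then show ?thesis using A unfolding f(3) by (subst null_sets_density_iff) auto
    qed
    also have "\<dots> \<longleftrightarrow> A \<in> null_sets lborel"
      using A by (subst AE_iff_null_sets) auto
    also have "\<dots> \<longleftrightarrow> negligible A"
      using A by (simp add: negligible_iff_null_sets null_sets_completion_iff)
    finally show ?thesis .
  qed
  then show ?thesis by unfold_locales (use sets in auto)
qed

theorem theorem1:
  fixes \<mu> :: "(real ^ 'n) measure"
  assumes "nice_measure \<mu>"
  shows "\<exists>P :: (real ^ 'n) set set.
           convex_partition (3 * 2 ^ (CARD('n) - 1)) P \<and>
           (\<forall>C\<in>P. \<forall>D\<in>P. measure \<mu> C = measure \<mu> D) \<and>
           (\<forall>H. hyperplane H \<longrightarrow> card {C\<in>P. avoids H C} \<ge> 2)"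
  using full_support_measure.partition_avoided_twice[OF nice_measure_full_support[OF assms]] by simp

end
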